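(* If $X$ is a coverable uniform space with $u\dim X\leq 1$, then $\widetilde{X}$ contains no simple closed curve (i.e. no topological circle).
   Context: A uniform open cover of a uniform space is an open cover that is refined by the cover by $F$-balls $B(x,F)=\{y:(x,y)\in F\}$ for some fixed entourage $F$. $u\dim X\leq n$ means that every uniform open cover of $X$ has a refinement by a uniform open cover of order $n+1$, i.e. one for which every point lies in at most $n+1$ of its sets. All entourages are taken to be symmetric. Fix a basepoint $*\in X$. For an entourage $E$ of $X$, an $E$-chain from $p$ to $q$ is a finite sequence $\{x_0=p,\dots,x_n=q\}$ with $(x_i,x_{i+1})\in E$ for all $i$. Two $E$-chains with the same endpoints are $E$-homotopic if one is obtained from the other in finitely many steps, each adding or removing a single point, always keeping the endpoints fixed and keeping an $E$-chain at each stage (in particular $\{p\}$ and $\{p,p\}$ are $E$-homotopic); $[\alpha]_E$ is the class of $\alpha$. $X_E$ is the set of $E$-homotopy classes of $E$-chains starting at $*$. For an entourage $D\subset E$ let $D^*$ be the set of pairs $([*=x_0,\dots,x_n,y]_E,[*=x_0,\dots,x_n,z]_E)$ with $(y,z)\in D$; $X_E$ carries the uniformity with base $\{D^*:D\subset E\}$. For $D\subset E$, $\phi_{ED}:X_D\to X_E$ is $[\alpha]_D\mapsto[\alpha]_E$. $\widetilde{X}=\varprojlim X_E$ (over all entourages, ordered by reverse inclusion, with the inverse limit uniformity), with projections $\phi_E:\widetilde{X}\to X_E$. $X$ is coverable if its uniformity has a base, containing $X\times X$, of entourages $E$ for which $\phi_E$ is surjective. *)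

theory Defs
  imports "HOL-Analysis.Analysis"
begin

definition entourage :: "('a::uniform_space \<times> 'a) set \<Rightarrow> bool" where
  "entourage E \<longleftrightarrow> sym E \<and> eventually (\<lambda>p. p \<in> E) uniformity"

definition entourage_ball :: "('a \<times> 'a) set \<Rightarrow> 'a \<Rightarrow> 'a set" where
  "entourage_ball F x = {y. (x, y) \<in> F}"

definition refines :: "'a set set \<Rightarrow> 'a set set \<Rightarrow> bool" where
  "refines \<V> \<U> \<longleftrightarrow> (\<forall>V\<in>\<V>. \<exists>U\<in>\<U>. V \<subseteq> U)"

definition uniform_open_cover :: "'a::uniform_space set set \<Rightarrow> bool" where
  "uniform_open_cover \<U> \<longleftrightarrow>
     (\<forall>U\<in>\<U>. open U) \<and> \<Union>\<U> = UNIV \<and>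
     (\<exists>F. entourage F \<and> refines (range (entourage_ball F)) \<U>)"

definition cover_order_le :: "'a set set \<Rightarrow> nat \<Rightarrow> bool" where
  "cover_order_le \<V> m \<longleftrightarrow> (\<forall>x. finite {V \<in> \<V>. x \<in> V} \<and> card {V \<in> \<V>. x \<in> V} \<le> m)"

definition udim_le :: "'a::uniform_space itself \<Rightarrow> nat \<Rightarrow> bool" where
  "udim_le _ n \<longleftrightarrow>
     (\<forall>\<U> :: 'a set set. uniform_open_cover \<U> \<longrightarrow>
        (\<exists>\<V>. uniform_open_cover \<V> \<and> refines \<V> \<U> \<and> cover_order_le \<V> (n + 1)))"

definition echain :: "('a \<times> 'a) set \<Rightarrow> 'a \<Rightarrow> 'a \<Rightarrow> 'a list \<Rightarrow> bool" where
  "echain E p q \<alpha> \<longleftrightarrow>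
     \<alpha> \<noteq> [] \<and> hd \<alpha> = p \<and> last \<alpha> = q \<and> successively (\<lambda>x y. (x, y) \<in> E) \<alpha>"

definition echain_insert :: "('a \<times> 'a) set \<Rightarrow> 'a list \<Rightarrow> 'a list \<Rightarrow> bool" where
  "echain_insert E \<alpha> \<beta> \<longleftrightarrow>
     (\<exists>p q. echain E p q \<alpha> \<and> echain E p q \<beta>) \<and>
     (\<exists>xs x ys. \<alpha> = xs @ ys \<and> \<beta> = xs @ x # ys)"

definition echain_homotopic :: "('a \<times> 'a) set \<Rightarrow> 'a list \<Rightarrow> 'a list \<Rightarrow> bool" where
  "echain_homotopic E = equivclp (echain_insert E)"

definition echain_class :: "('a \<times> 'a) set \<Rightarrow> 'a list \<Rightarrow> 'a list set" where
  "echain_class E \<alpha> = {\<beta>. echain_homotopic E \<alpha> \<beta>}"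

definition chain_space :: "'a \<Rightarrow> ('a \<times> 'a) set \<Rightarrow> 'a list set set" where
  "chain_space b E = {echain_class E \<alpha> |\<alpha> q. echain E b q \<alpha>}"

text \<open>In \<open>star b E D\<close>, written $D^*$ in the literature, \<open>\<alpha>\<close> is the nonempty initial part $* = x_0, \dots, x_n$
  common to both chains.\<close>

definition star :: "'a \<Rightarrow> ('a \<times> 'a) set \<Rightarrow> ('a \<times> 'a) set \<Rightarrow> ('a list set \<times> 'a list set) set" where
  "star b E D =
     {(echain_class E (\<alpha> @ [y]), echain_class E (\<alpha> @ [z])) |\<alpha> y z.
        \<alpha> \<noteq> [] \<and> echain E b y (\<alpha> @ [y]) \<and> echain E b z (\<alpha> @ [z]) \<and> (y, z) \<in> D}"

definition chain_uniformity ::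
    "'a::uniform_space \<Rightarrow> ('a \<times> 'a) set \<Rightarrow> ('a list set \<times> 'a list set) filter" where
  "chain_uniformity b E = (INF D\<in>{D. entourage D \<and> D \<subseteq> E}. principal (star b E D))"

text \<open>The bonding map sends a class \<open>c\<close> to the class of any of its members; the union is over
  equal sets (lemma \<open>bonding_echain_class\<close>).\<close>

definition bonding :: "('a \<times> 'a) set \<Rightarrow> 'a list set \<Rightarrow> 'a list set" where
  "bonding E c = (\<Union>\<alpha>\<in>c. echain_class E \<alpha>)"

definition limit_space :: "'a::uniform_space \<Rightarrow> (('a \<times> 'a) set \<Rightarrow> 'a list set) set" where
  "limit_space b =
     {f \<in> (\<Pi>\<^sub>E E\<in>{E. entourage E}. chain_space b E).
        \<forall>D E. entourage D \<longrightarrow> entourage E \<longrightarrow> D \<subseteq> E \<longrightarrow> bonding E (f D) = f E}"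

definition limit_proj :: "('a \<times> 'a) set \<Rightarrow> (('a \<times> 'a) set \<Rightarrow> 'a list set) \<Rightarrow> 'a list set" where
  "limit_proj E f = f E"

definition limit_uniformity ::
    "'a::uniform_space \<Rightarrow>
      ((('a \<times> 'a) set \<Rightarrow> 'a list set) \<times> (('a \<times> 'a) set \<Rightarrow> 'a list set)) filter" where
  "limit_uniformity b =
     inf (principal (limit_space b \<times> limit_space b))
       (INF E\<in>{E. entourage E}.
          filtercomap (map_prod (limit_proj E) (limit_proj E)) (chain_uniformity b E))"

text \<open>The topology induced by a uniformity on a carrier set \<open>S\<close>, as in class
  \<open>open_uniformity\<close>.\<close>

definition uniformity_topology :: "'b set \<Rightarrow> ('b \<times> 'b) filter \<Rightarrow> 'b topology" where
  "uniformity_topology S \<Phi> =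
     topology (\<lambda>U. U \<subseteq> S \<and> (\<forall>x\<in>U. eventually (\<lambda>(x', y). x' = x \<longrightarrow> y \<in> U) \<Phi>))"

definition limit_topology ::
    "'a::uniform_space \<Rightarrow> (('a \<times> 'a) set \<Rightarrow> 'a list set) topology" where
  "limit_topology b = uniformity_topology (limit_space b) (limit_uniformity b)"

definition coverable :: "'a::uniform_space \<Rightarrow> bool" where
  "coverable b \<longleftrightarrow>
     (\<exists>\<B>. UNIV \<in> \<B> \<and>
        (\<forall>E\<in>\<B>. entourage E \<and> limit_proj E ` limit_space b = chain_space b E) \<and>
        (\<forall>U. eventually (\<lambda>p. p \<in> U) uniformity \<longrightarrow> (\<exists>E\<in>\<B>. E \<subseteq> U)))"

definition simple_closed_curve_in :: "'b topology \<Rightarrow> 'b set \<Rightarrow> bool" where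
  "simple_closed_curve_in T C \<longleftrightarrow>
     C \<subseteq> topspace T \<and> subtopology T C homeomorphic_space top_of_set (sphere (0::complex) 1)"

lemma entourage_Int: "entourage D \<Longrightarrow> entourage D' \<Longrightarrow> entourage (D \<inter> D')"
  unfolding entourage_def by (auto simp: sym_Int eventually_conj)

lemma star_mono: "D \<subseteq> D' \<Longrightarrow> star b E D \<subseteq> star b E D'"
  unfolding star_def by blast

lemma eventually_chain_uniformity:
  assumes "entourage E"
  shows "eventually P (chain_uniformity b E) \<longleftrightarrow>
    (\<exists>D. entourage D \<and> D \<subseteq> E \<and> (\<forall>p \<in> star b E D. P p))"
  unfolding chain_uniformity_def
proof (subst eventually_INF_base)
  show "{D. entourage D \<and> D \<subseteq> E} \<noteq> {}" using assms by blast
  fix D D' assume "D \<in> {D. entourage D \<and> D \<subseteq> E}" "D' \<in> {D. entourage D \<and> D \<subseteq> E}"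
  then show "\<exists>x\<in>{D. entourage D \<and> D \<subseteq> E}. principal (star b E x)
      \<le> inf (principal (star b E D)) (principal (star b E D'))"
    by (intro bexI[of _ "D \<inter> D'"]) (auto intro: entourage_Int star_mono[THEN subsetD])
qed (auto simp: eventually_principal)

lemma echain_homotopic_mono:
  assumes "D \<subseteq> E" "echain_homotopic D \<alpha> \<beta>"
  shows "echain_homotopic E \<alpha> \<beta>"
proof -
  have "echain E p q \<gamma>" if "echain D p q \<gamma>" for p q \<gamma>
    using that assms(1) unfolding echain_def by (auto intro: successively_mono)
  then have "echain_insert D \<gamma> \<delta> \<Longrightarrow> echain_insert E \<gamma> \<delta>" for \<gamma> \<delta>
    unfolding echain_insert_def by blast
  then have "symclp (echain_insert D) \<le> symclp (echain_insert E)"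
    by (auto simp: symclp_def)
  from rtranclp_mono[OF this] assms(2) show ?thesis
    unfolding echain_homotopic_def equivclp_def by blast
qed

lemma echain_class_eq: "echain_homotopic E \<alpha> \<beta> \<Longrightarrow> echain_class E \<alpha> = echain_class E \<beta>"
  unfolding echain_class_def echain_homotopic_def
  by (auto intro: equivclp_trans equivclp_sym)

lemma bonding_echain_class:
  assumes "D \<subseteq> E"
  shows "bonding E (echain_class D \<alpha>) = echain_class E \<alpha>"
proof -
  have "\<alpha> \<in> echain_class D \<alpha>"
    by (simp add: echain_class_def echain_homotopic_def)
  moreover have "echain_class E \<beta> = echain_class E \<alpha>" if "\<beta> \<in> echain_class D \<alpha>" for \<beta>
    using that echain_class_eq[OF echain_homotopic_mono[OF assms]]
    by (auto simp: echain_class_def)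
  ultimately show ?thesis unfolding bonding_def by blast
qed

lemma openin_uniformity_topology:
  "openin (uniformity_topology S \<Phi>) U \<longleftrightarrow>
     U \<subseteq> S \<and> (\<forall>x\<in>U. eventually (\<lambda>(x', y). x' = x \<longrightarrow> y \<in> U) \<Phi>)"
proof -
  have "istopology (\<lambda>U. U \<subseteq> S \<and> (\<forall>x\<in>U. eventually (\<lambda>(x', y). x' = x \<longrightarrow> y \<in> U) \<Phi>))"
    unfolding istopology_def
  proof (intro conjI allI impI ballI)
    fix U V x
    assume U: "U \<subseteq> S \<and> (\<forall>x\<in>U. eventually (\<lambda>(x', y). x' = x \<longrightarrow> y \<in> U) \<Phi>)"
      and V: "V \<subseteq> S \<and> (\<forall>x\<in>V. eventually (\<lambda>(x', y). x' = x \<longrightarrow> y \<in> V) \<Phi>)"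
    show "U \<inter> V \<subseteq> S" using U by blast
    assume "x \<in> U \<inter> V"
    then have "eventually (\<lambda>(x', y). x' = x \<longrightarrow> y \<in> U) \<Phi>"
      "eventually (\<lambda>(x', y). x' = x \<longrightarrow> y \<in> V) \<Phi>" using U V by auto
    then show "eventually (\<lambda>(x', y). x' = x \<longrightarrow> y \<in> U \<inter> V) \<Phi>"
      by eventually_elim auto
  next
    fix K x
    assume K: "\<forall>U\<in>K. U \<subseteq> S \<and> (\<forall>x\<in>U. eventually (\<lambda>(x', y). x' = x \<longrightarrow> y \<in> U) \<Phi>)"
    show "\<Union>K \<subseteq> S" using K by blast
    assume "x \<in> \<Union>K"
    then obtain U where "U \<in> K" "x \<in> U" by blast
    with K have "eventually (\<lambda>(x', y). x' = x \<longrightarrow> y \<in> U) \<Phi>" by blast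
    then show "eventually (\<lambda>(x', y). x' = x \<longrightarrow> y \<in> \<Union>K) \<Phi>"
      by eventually_elim (use \<open>U \<in> K\<close> in auto)
  qed
  then show ?thesis
    unfolding uniformity_topology_def by (simp add: topology_inverse')
qed

lemma topspace_limit_topology: "topspace (limit_topology b) = limit_space b"
proof -
  have "eventually (\<lambda>p. p \<in> limit_space b \<times> limit_space b) (limit_uniformity b)"
    unfolding limit_uniformity_def
    by (rule filter_leD[OF inf_le1]) (simp add: eventually_principal)
  then have "openin (limit_topology b) (limit_space b)"
    unfolding limit_topology_def openin_uniformity_topology
    by (auto elim: eventually_mono)
  moreover have "topspace (limit_topology b) \<subseteq> limit_space b"
    using openin_topspace[of "limit_topology b"]
    unfolding limit_topology_def openin_uniformity_topology by blast
  ultimately show ?thesis by (simp add: openin_subset subset_antisym)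
qed

end

theory Submission
  imports Defs
begin

text \<open>The proof compares two ways of measuring how often a closed polygon winds around a circle
  embedded in \<open>lim X\<^sub>E\<close>.

  The inverse of the embedding is uniformly continuous, so some stage \<open>X\<^sub>E\<close> of the limit already
  separates points of the circle that are \<open>1/3\<close> apart
  (\<open>compact_embedding_separated_at_stage\<close>). The dimension bound gives a uniform open cover of \<open>X\<close>
  by \<open>E\<close>-small sets of order two. Each of its members lifts to disjoint sheets in \<open>X\<^sub>E\<close>, and the
  cover of \<open>X\<^sub>E\<close> by all sheets again has order two (\<open>sheets_order_two\<close>). Its nerve is therefore a
  graph, into which the circle maps with fibres of diameter less than \<open>1/3\<close>.

  On a graph every antisymmetric function on the edges is a cocycle, because there are no triangles
  on which a condition could fail. Representing each sheet that meets the circle by a point in it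
  turns (twice) the angle on the circle into such a function, and the order of the cover lets it
  descend to a function \<open>d\<close> on pairs of points of \<open>X\<^sub>E\<close> with a common sheet that satisfies \<open>d u w = d u v + d v w\<close>
  (\<open>angle_cocycle\<close>). On pairs of points of the circle with a common sheet, \<open>d\<close> is
  twice the angle up to a coboundary.

  Let \<open>F\<close> be an entourage whose balls refine the cover. Every \<open>F\<close>-chain from the base point lifts to
  \<open>X\<^sub>E\<close>, and additivity makes the sum of \<open>d\<close> along the lift invariant under \<open>F\<close>-homotopy
  (\<open>lifted_sum_homotopic\<close>). The vertices of a fine polygon inscribed in the circle project to classes
  in \<open>X\<^sub>F\<close>, each of which is obtained from the preceding one by appending a point
  (\<open>chain_along_limit_sequence\<close>). After one turn the class is the initial one, so the sum has not
  changed. But the sum has also grown by twice the total angle swept by the polygon, which is not zero,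
  while the coboundary cancels around the polygon. This is a contradiction.\<close>

section \<open>Entourages\<close>

lemma entourage_refl: "entourage E \<Longrightarrow> (x, x) \<in> E"
  unfolding entourage_def using uniformity_refl[of "\<lambda>p. p \<in> E"] by blast

lemma entourage_sym: "entourage E \<Longrightarrow> (x, y) \<in> E \<Longrightarrow> (y, x) \<in> E"
  unfolding entourage_def by (blast dest: symD)

lemma entourage_UNIV: "entourage UNIV"
  by (simp add: entourage_def sym_def)

lemma entourage_half:
  assumes "entourage E"
  obtains D where "entourage D" "D O D \<subseteq> E" "D \<subseteq> E"
proof -
  obtain P where P: "eventually P uniformity" "\<And>x y z. P (x, y) \<Longrightarrow> P (y, z) \<Longrightarrow> (x, z) \<in> E"
    using assms uniformity_transE[of "\<lambda>p. p \<in> E"] unfolding entourage_def by metis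
  define D where "D = {(x, y). P (x, y) \<and> P (y, x)}"
  have "eventually (\<lambda>p. p \<in> D) uniformity"
    using eventually_conj[OF P(1) uniformity_sym[OF P(1)]]
    by (rule eventually_mono) (auto simp: D_def)
  then have D: "entourage D"
    by (auto simp: entourage_def sym_def D_def)
  moreover have DD: "D O D \<subseteq> E"
    using P(2) unfolding D_def by (auto simp only: relcomp_unfold subset_iff)
  moreover have "D \<subseteq> E"
  proof
    fix p assume "p \<in> D"
    then have "(fst p, snd p) \<in> D O D"
      using entourage_refl[OF D, of "fst p"] by (intro relcompI[of _ "fst p"]) auto
    then show "p \<in> E"
      using subsetD[OF DD] by simp
  qed
  ultimately show ?thesis
    by (rule that)
qed

text \<open>The small open sets are interiors of balls: if \<open>D\<close> and then \<open>D'\<close> are successive halves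
  of \<open>E\<close>, the interior of a \<open>D\<close>-ball is \<open>E\<close>-small and contains the concentric \<open>D'\<close>-ball.\<close>

lemma small_uniform_open_cover:
  fixes E :: "('a::uniform_space \<times> 'a) set"
  assumes "entourage E"
  obtains \<U> :: "'a set set" where "uniform_open_cover \<U>" "\<And>U. U \<in> \<U> \<Longrightarrow> U \<times> U \<subseteq> E"
proof -
  obtain D where D: "entourage D" "D O D \<subseteq> E"
    using entourage_half[OF assms] by metis
  obtain D' where D': "entourage D'" "D' O D' \<subseteq> D"
    using entourage_half[OF D(1)] by metis
  define \<U> where "\<U> = range (\<lambda>x. interior (entourage_ball D x))"
  have ball: "entourage_ball D' x \<subseteq> interior (entourage_ball D x)" for x
  proof
    fix y assume y: "y \<in> entourage_ball D' x"
    have "eventually (\<lambda>(y', z). y' = y \<longrightarrow> z \<in> entourage_ball D x) uniformity"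
      using D'(1) unfolding entourage_def
      by (auto elim!: eventually_mono) (use D'(2) y in \<open>auto simp: entourage_ball_def\<close>)
    then have "eventually (\<lambda>z. z \<in> entourage_ball D x) (nhds y)"
      by (simp add: eventually_nhds_uniformity)
    then show "y \<in> interior (entourage_ball D x)"
      by (auto simp: eventually_nhds interior_def)
  qed
  have "refines (range (entourage_ball D')) \<U>"
    using ball by (auto simp: refines_def \<U>_def)
  moreover have "\<Union>\<U> = UNIV"
    using ball entourage_refl[OF D'(1)] by (auto simp: \<U>_def entourage_ball_def)
  ultimately have "uniform_open_cover \<U>"
    using D'(1) by (auto simp: uniform_open_cover_def \<U>_def)
  moreover have "U \<times> U \<subseteq> E" if "U \<in> \<U>" for U
  proof -
    have "\<exists>x. U \<subseteq> entourage_ball D x"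
      using that interior_subset by (fastforce simp: \<U>_def)
    then obtain x where "U \<subseteq> entourage_ball D x" ..
    then have "(y, x) \<in> D \<and> (x, z) \<in> D" if "y \<in> U" "z \<in> U" for y z
      using that entourage_sym[OF D(1)] by (auto simp: entourage_ball_def)
    then show ?thesis
      using D(2) by blast
  qed
  ultimately show ?thesis
    by (rule that)
qed

section \<open>Chains and their classes\<close>

lemma echain_snoc_iff:
  "echain E p q (\<alpha> @ [z]) \<longleftrightarrow>
     q = z \<and> (if \<alpha> = [] then p = z else echain E p (last \<alpha>) \<alpha> \<and> (last \<alpha>, z) \<in> E)"
  by (auto simp: echain_def successively_append_iff)

lemma echain_mono: "echain D p q \<alpha> \<Longrightarrow> D \<subseteq> E \<Longrightarrow> echain E p q \<alpha>"
  unfolding echain_def by (auto intro: successively_mono)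

lemma echain_last: "echain E p q \<alpha> \<Longrightarrow> last \<alpha> = q"
  by (simp add: echain_def)

lemma echain_not_Nil: "echain E p q \<alpha> \<Longrightarrow> \<alpha> \<noteq> []"
  by (simp add: echain_def)

lemma echain_class_eq_iff: "echain_class E \<alpha> = echain_class E \<beta> \<longleftrightarrow> echain_homotopic E \<alpha> \<beta>"
proof
  assume "echain_class E \<alpha> = echain_class E \<beta>"
  moreover have "\<beta> \<in> echain_class E \<beta>"
    by (simp add: echain_class_def echain_homotopic_def)
  ultimately show "echain_homotopic E \<alpha> \<beta>"
    unfolding echain_class_def by blast
qed (rule echain_class_eq)

lemma echain_homotopic_last: "echain_homotopic E \<alpha> \<beta> \<Longrightarrow> last \<alpha> = last \<beta>"
  unfolding echain_homotopic_def
  by (induction rule: equivclp_induct) (auto simp: echain_insert_def dest!: echain_last)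

lemma echain_insert_snoc:
  assumes "echain_insert E \<alpha> \<beta>" "(last \<alpha>, z) \<in> E"
  shows "echain_insert E (\<alpha> @ [z]) (\<beta> @ [z])"
proof -
  obtain p q where "echain E p q \<alpha>" "echain E p q \<beta>"
    using assms(1) unfolding echain_insert_def by blast
  then have "echain E p z (\<alpha> @ [z])" "echain E p z (\<beta> @ [z])"
    using assms(2) by (auto simp: echain_snoc_iff echain_last echain_not_Nil)
  moreover obtain xs x ys where "\<alpha> = xs @ ys" "\<beta> = xs @ x # ys"
    using assms(1) unfolding echain_insert_def by blast
  then have "\<alpha> @ [z] = xs @ (ys @ [z])" "\<beta> @ [z] = xs @ x # (ys @ [z])"
    by auto
  ultimately show ?thesis
    unfolding echain_insert_def by blast
qed

text \<open>An insertion step fixes both endpoints, so the same step can be carried out in front of an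
  appended point.\<close>

lemma echain_homotopic_snoc:
  assumes "echain_homotopic E \<alpha> \<beta>" "(last \<alpha>, z) \<in> E"
  shows "echain_homotopic E (\<alpha> @ [z]) (\<beta> @ [z])"
  using assms(1) unfolding echain_homotopic_def
proof (induction rule: equivclp_induct)
  case (step \<beta> \<gamma>)
  from step have "echain_homotopic E \<alpha> \<beta>" "echain_homotopic E \<alpha> \<gamma>"
    unfolding echain_homotopic_def by (blast intro: equivclp_into_equivclp)+
  then have "last \<alpha> = last \<beta>" "last \<alpha> = last \<gamma>"
    by (blast dest: echain_homotopic_last)+
  then have "echain_insert E (\<beta> @ [z]) (\<gamma> @ [z]) \<or> echain_insert E (\<gamma> @ [z]) (\<beta> @ [z])"
    using step.hyps(2) assms(2) echain_insert_snoc by metis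
  then show ?case
    using step.IH by (rule equivclp_into_equivclp[rotated])
qed simp

lemma echain_class_snoc_cong:
  "echain_class E \<alpha> = echain_class E \<beta> \<Longrightarrow> (last \<alpha>, z) \<in> E \<Longrightarrow>
    echain_class E (\<alpha> @ [z]) = echain_class E (\<beta> @ [z])"
  by (simp add: echain_class_eq_iff echain_homotopic_snoc)

lemma echain_class_eq_last: "echain_class E \<alpha> = echain_class E \<beta> \<Longrightarrow> last \<alpha> = last \<beta>"
  by (simp add: echain_class_eq_iff echain_homotopic_last)

lemma echain_class_insert: "echain_insert E \<alpha> \<beta> \<Longrightarrow> echain_class E \<alpha> = echain_class E \<beta>"
  unfolding echain_class_eq_iff echain_homotopic_def by (rule r_into_equivclp)

text \<open>A triangle with all three sides in \<open>E\<close> can be cut short.\<close>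

lemma echain_class_shortcut:
  assumes "echain E b q \<alpha>" "(q, y) \<in> E" "(y, z) \<in> E" "(q, z) \<in> E"
  shows "echain_class E (\<alpha> @ [y, z]) = echain_class E (\<alpha> @ [z])"
proof -
  have "echain E b z (\<alpha> @ [z])" "echain E b z ((\<alpha> @ [y]) @ [z])"
    using assms by (auto simp: echain_snoc_iff echain_last echain_not_Nil simp del: append_assoc)
  then have "echain_insert E (\<alpha> @ [z]) (\<alpha> @ y # [z])"
    unfolding echain_insert_def by fastforce
  then show ?thesis
    by (simp add: echain_class_insert)
qed

lemma echain_class_repeat_last:
  assumes "echain E b q \<alpha>" "(q, q) \<in> E"
  shows "echain_class E (\<alpha> @ [q]) = echain_class E \<alpha>"
proof -
  have "echain E b q (\<alpha> @ [q])"
    using assms by (auto simp: echain_snoc_iff echain_last echain_not_Nil)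
  moreover have "\<alpha> = \<alpha> @ []" "\<alpha> @ [q] = \<alpha> @ q # []"
    by auto
  ultimately have "echain_insert E \<alpha> (\<alpha> @ [q])"
    using assms(1) unfolding echain_insert_def by blast
  then show ?thesis
    by (simp add: echain_class_insert)
qed

text \<open>Two classes are \<open>D\<close>-close exactly when one arises from the other by appending a point that
  is \<open>D\<close>-close to the endpoint; this avoids the common initial part of the definition.\<close>

lemma starI:
  assumes "entourage E" "echain E b q \<alpha>" "(q, z) \<in> D" "D \<subseteq> E"
  shows "(echain_class E \<alpha>, echain_class E (\<alpha> @ [z])) \<in> star b E D"
proof -
  have "echain E b q (\<alpha> @ [q])" "echain E b z (\<alpha> @ [z])" "\<alpha> \<noteq> []"
    using assms entourage_refl[OF assms(1)]
    by (auto simp: echain_snoc_iff echain_last echain_not_Nil)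
  then have "(echain_class E (\<alpha> @ [q]), echain_class E (\<alpha> @ [z])) \<in> star b E D"
    using assms(3) unfolding star_def by blast
  then show ?thesis
    using echain_class_repeat_last[OF assms(2)] entourage_refl[OF assms(1)] by simp
qed

lemma starE:
  assumes "(u, v) \<in> star b E D" "D \<subseteq> E"
  obtains \<alpha> q z where "echain E b q \<alpha>" "(q, z) \<in> D" "u = echain_class E \<alpha>"
    "v = echain_class E (\<alpha> @ [z])"
proof -
  obtain \<alpha> y z where a: "\<alpha> \<noteq> []" "echain E b y (\<alpha> @ [y])" "echain E b z (\<alpha> @ [z])" "(y, z) \<in> D"
    "u = echain_class E (\<alpha> @ [y])" "v = echain_class E (\<alpha> @ [z])"
    using assms(1) unfolding star_def by blast
  then have "v = echain_class E ((\<alpha> @ [y]) @ [z])"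
    using assms(2) echain_class_shortcut[of E b "last \<alpha>" \<alpha> y z] by (auto simp: echain_snoc_iff)
  then show ?thesis
    using a that[of y "\<alpha> @ [y]" z] by blast
qed

lemma star_sym: "entourage D \<Longrightarrow> (u, v) \<in> star b E D \<Longrightarrow> (v, u) \<in> star b E D"
  unfolding star_def by clarsimp (metis entourage_sym)

lemma star_extend:
  assumes "(echain_class E \<alpha>, v) \<in> star b E D" "D \<subseteq> E"
  obtains z where "(last \<alpha>, z) \<in> D" "v = echain_class E (\<alpha> @ [z])"
proof -
  obtain \<beta> q z where "echain E b q \<beta>" "(q, z) \<in> D" "echain_class E \<alpha> = echain_class E \<beta>"
    "v = echain_class E (\<beta> @ [z])"
    using assms by (rule starE)
  then show ?thesis
    using that[of z] echain_class_snoc_cong[of E \<alpha> \<beta> z] echain_class_eq_last[of E \<alpha> \<beta>] assms(2)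
    by (auto simp: echain_last)
qed

section \<open>The topology of the inverse limit\<close>

definition limit_close ::
    "'a::uniform_space \<Rightarrow> ('a \<times> 'a) set \<Rightarrow> (('a \<times> 'a) set \<Rightarrow> 'a list set) \<Rightarrow>
      (('a \<times> 'a) set \<Rightarrow> 'a list set) \<Rightarrow> bool" where
  "limit_close b E f g \<longleftrightarrow> (f E, g E) \<in> star b E E"

lemma limit_space_bonding:
  "f \<in> limit_space b \<Longrightarrow> entourage D \<Longrightarrow> entourage E \<Longrightarrow> D \<subseteq> E \<Longrightarrow> bonding E (f D) = f E"
  unfolding limit_space_def by blast

lemma limit_space_component:
  assumes "f \<in> limit_space b" "entourage E"
  obtains \<alpha> q where "echain E b q \<alpha>" "f E = echain_class E \<alpha>"
proof -
  have "f E \<in> chain_space b E"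
    using assms unfolding limit_space_def by (auto dest: PiE_mem)
  then show ?thesis
    using that unfolding chain_space_def by blast
qed

lemma limit_close_star:
  assumes "f \<in> limit_space b" "g \<in> limit_space b" "entourage D" "entourage E" "D \<subseteq> E"
    "limit_close b D f g"
  shows "(f E, g E) \<in> star b E D"
proof -
  obtain \<alpha> q z where a: "echain D b q \<alpha>" "(q, z) \<in> D" "f D = echain_class D \<alpha>"
      "g D = echain_class D (\<alpha> @ [z])"
    using assms(6) unfolding limit_close_def by (rule starE) auto
  have "f E = echain_class E \<alpha>" "g E = echain_class E (\<alpha> @ [z])"
    using limit_space_bonding[OF _ assms(3-5)] assms(1,2) a(3,4) bonding_echain_class[OF assms(5)]
    by metis+
  then show ?thesis
    using starI[OF assms(4) echain_mono[OF a(1) assms(5)] a(2) assms(5)] by simp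
qed

lemma limit_close_mono:
  assumes "f \<in> limit_space b" "g \<in> limit_space b" "entourage D" "entourage E" "D \<subseteq> E"
    "limit_close b D f g"
  shows "limit_close b E f g"
  using limit_close_star[OF assms] star_mono[OF assms(5)] unfolding limit_close_def by blast

lemma limit_close_refl:
  assumes "f \<in> limit_space b" "entourage E"
  shows "limit_close b E f f"
proof -
  obtain \<alpha> q where a: "echain E b q \<alpha>" "f E = echain_class E \<alpha>"
    using assms by (rule limit_space_component)
  then show ?thesis
    using starI[OF assms(2) a(1) entourage_refl[OF assms(2)] order_refl]
      echain_class_repeat_last[OF a(1) entourage_refl[OF assms(2)]]
    by (simp add: limit_close_def)
qed

lemma limit_close_sym: "entourage E \<Longrightarrow> limit_close b E f g \<Longrightarrow> limit_close b E g f"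
  unfolding limit_close_def by (rule star_sym)

text \<open>Classes in \<open>X\<^sub>D\<close> that are two \<open>D\<close>-steps apart are joined by one \<open>E\<close>-step in \<open>X\<^sub>E\<close>: the intermediate
  point spans an \<open>E\<close>-triangle with its neighbours and can be dropped.\<close>

lemma limit_close_trans:
  assumes lim: "f \<in> limit_space b" "g \<in> limit_space b" "h \<in> limit_space b"
    and ent: "entourage D" "entourage E" "D \<subseteq> E" "D O D \<subseteq> E"
    and fg: "limit_close b D f g" and gh: "limit_close b D g h"
  shows "limit_close b E f h"
proof -
  obtain \<alpha> q z where a: "echain D b q \<alpha>" "(q, z) \<in> D" "f D = echain_class D \<alpha>"
      "g D = echain_class D (\<alpha> @ [z])"
    using fg unfolding limit_close_def by (rule starE) auto
  obtain w where w: "(z, w) \<in> D" "h D = echain_class D ((\<alpha> @ [z]) @ [w])"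
    using star_extend[of D "\<alpha> @ [z]" "h D" b D] gh a(4) unfolding limit_close_def by auto
  have qw: "(q, w) \<in> E"
    using a(2) w(1) ent(4) by blast
  have \<alpha>: "echain E b q \<alpha>"
    using a(1) ent(3) by (rule echain_mono)
  have "f E = echain_class E \<alpha>" "h E = echain_class E (\<alpha> @ [z, w])"
    using limit_space_bonding[OF _ ent(1-3)] lim(1,3) a(3) w(2) bonding_echain_class[OF ent(3)]
    by (metis append_assoc append_Cons append_Nil)+
  moreover have "echain_class E (\<alpha> @ [z, w]) = echain_class E (\<alpha> @ [w])"
    using a(2) w(1) qw ent(3) \<alpha> by (intro echain_class_shortcut) auto
  ultimately show ?thesis
    using starI[OF ent(2) \<alpha> qw order_refl] by (simp add: limit_close_def)
qed

text \<open>For \<open>D \<subseteq> E\<close>, closeness in \<open>X\<^sub>D\<close> at scale \<open>D\<close> implies closeness in \<open>X\<^sub>E\<close> at the same scale,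
  so a single family of relations indexed by entourages is a base of the limit uniformity.\<close>

lemma eventually_limit_uniformity:
  assumes "eventually P (limit_uniformity b)"
  obtains E where "entourage E"
    "\<And>f g. f \<in> limit_space b \<Longrightarrow> g \<in> limit_space b \<Longrightarrow> limit_close b E f g \<Longrightarrow> P (f, g)"
proof -
  define R where
    "R E = {(f, g). f \<in> limit_space b \<and> g \<in> limit_space b \<and> limit_close b E f g}" for E
  define \<Phi> where "\<Phi> = (INF E\<in>{E. entourage E}. principal (R E))"
  have R_in: "eventually (\<lambda>p. p \<in> R E) \<Phi>" if "entourage E" for E
    unfolding \<Phi>_def using that by (intro eventually_INF1[of E]) (auto simp: eventually_principal)
  have base: "(\<exists>E. entourage E \<and> (\<forall>p \<in> R E. Q p))" if "eventually Q \<Phi>" for Q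
  proof -
    have "\<exists>E\<in>{E. entourage E}. eventually Q (principal (R E))"
    proof (rule eventually_INF_base[THEN iffD1, OF _ _ that[unfolded \<Phi>_def]])
      show "{E :: ('a \<times> 'a) set. entourage E} \<noteq> {}"
        using entourage_UNIV by blast
      fix D E :: "('a \<times> 'a) set"
      assume "D \<in> {E. entourage E}" "E \<in> {E. entourage E}"
      then have "entourage D" "entourage E" "entourage (D \<inter> E)"
        by (auto intro: entourage_Int)
      moreover from this have "R (D \<inter> E) \<subseteq> R D \<inter> R E"
        unfolding R_def by (auto elim!: limit_close_mono[rotated 5])
      ultimately show "\<exists>x\<in>{E. entourage E}. principal (R x) \<le> inf (principal (R D)) (principal (R E))"
        by (intro bexI[of _ "D \<inter> E"]) auto
    qed
    then show ?thesis
      by (auto simp: eventually_principal)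
  qed
  have "\<Phi> \<le> limit_uniformity b"
    unfolding limit_uniformity_def
  proof (intro inf_greatest INF_greatest)
    show "\<Phi> \<le> principal (limit_space b \<times> limit_space b)"
      unfolding le_principal
      using R_in[OF entourage_UNIV] by (rule eventually_mono) (auto simp: R_def)
  next
    fix E :: "('a \<times> 'a) set" assume "E \<in> {E. entourage E}"
    then have E: "entourage E" by simp
    show "\<Phi> \<le> filtercomap (map_prod (limit_proj E) (limit_proj E)) (chain_uniformity b E)"
    proof (rule filter_leI)
      fix Q assume "eventually Q (filtercomap (map_prod (limit_proj E) (limit_proj E)) (chain_uniformity b E))"
      then obtain Q' where Q': "eventually Q' (chain_uniformity b E)"
          "\<And>p. Q' (map_prod (limit_proj E) (limit_proj E) p) \<Longrightarrow> Q p"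
        unfolding eventually_filtercomap by blast
      then obtain D where D: "entourage D" "D \<subseteq> E" "\<And>p. p \<in> star b E D \<Longrightarrow> Q' p"
        unfolding eventually_chain_uniformity[OF E] by blast
      from R_in[OF D(1)] show "eventually Q \<Phi>"
      proof (rule eventually_mono)
        fix p assume "p \<in> R D"
        then have "map_prod (limit_proj E) (limit_proj E) p \<in> star b E D"
          using limit_close_star[OF _ _ D(1) E D(2)] by (auto simp: R_def limit_proj_def)
        then show "Q p" using D(3) Q'(2) by blast
      qed
    qed
  qed
  then have "eventually P \<Phi>"
    using assms by (rule filter_leD)
  then show ?thesis
    using base[of P] that by (auto simp: R_def)
qed

lemma eventually_limit_close:
  assumes "entourage E"
  shows "eventually (\<lambda>(f, g). f \<in> limit_space b \<and> g \<in> limit_space b \<and> limit_close b E f g)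
    (limit_uniformity b)"
proof -
  have "eventually (\<lambda>p. p \<in> star b E E) (chain_uniformity b E)"
    using assms by (auto simp: eventually_chain_uniformity)
  then have "eventually (\<lambda>p. map_prod (limit_proj E) (limit_proj E) p \<in> star b E E)
      (INF E\<in>{E. entourage E}.
          filtercomap (map_prod (limit_proj E) (limit_proj E)) (chain_uniformity b E))"
    using assms by (intro eventually_INF1[of E]) (auto intro: eventually_filtercomapI)
  then have "eventually (\<lambda>p. map_prod (limit_proj E) (limit_proj E) p \<in> star b E E)
      (limit_uniformity b)"
    unfolding limit_uniformity_def by (rule filter_leD[OF inf_le2])
  moreover have "eventually (\<lambda>p. p \<in> limit_space b \<times> limit_space b) (limit_uniformity b)"
    unfolding limit_uniformity_def
    by (rule filter_leD[OF inf_le1]) (simp add: eventually_principal)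
  ultimately show ?thesis
    by eventually_elim (auto simp: limit_close_def limit_proj_def)
qed

lemma openin_limit_topologyE:
  assumes "openin (limit_topology b) U" "f \<in> U"
  obtains E where "entourage E" "\<And>g. g \<in> limit_space b \<Longrightarrow> limit_close b E f g \<Longrightarrow> g \<in> U"
proof -
  have "f \<in> limit_space b"
    using assms openin_subset by (fastforce simp: topspace_limit_topology)
  moreover have "eventually (\<lambda>(x', y). x' = f \<longrightarrow> y \<in> U) (limit_uniformity b)"
    using assms unfolding limit_topology_def openin_uniformity_topology by blast
  ultimately show ?thesis
    using that by (auto elim!: eventually_limit_uniformity)
qed

text \<open>The set \<open>U\<close> is the interior of the \<open>E\<close>-ball around \<open>f\<close>, described through the uniformity.\<close>

lemma limit_close_neighbourhood:
  assumes "entourage E" "f \<in> limit_space b"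
  obtains U where "openin (limit_topology b) U" "f \<in> U" "\<And>g. g \<in> U \<Longrightarrow> limit_close b E f g"
proof -
  define U where "U = {g \<in> limit_space b. \<exists>D. entourage D \<and>
    (\<forall>h\<in>limit_space b. limit_close b D g h \<longrightarrow> limit_close b E f h)}"
  have "openin (limit_topology b) U"
    unfolding limit_topology_def openin_uniformity_topology
  proof (intro conjI ballI)
    show "U \<subseteq> limit_space b" by (auto simp: U_def)
    fix g assume "g \<in> U"
    then obtain D where g: "g \<in> limit_space b" and D: "entourage D"
      "\<And>h. h \<in> limit_space b \<Longrightarrow> limit_close b D g h \<Longrightarrow> limit_close b E f h"
      by (auto simp: U_def)
    obtain D' where D': "entourage D'" "D' O D' \<subseteq> D" "D' \<subseteq> D"
      using D(1) by (rule entourage_half)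
    from eventually_limit_close[OF D'(1), of b]
    show "eventually (\<lambda>(x', y). x' = g \<longrightarrow> y \<in> U) (limit_uniformity b)"
    proof eventually_elim
      case (elim p)
      have "h \<in> U" if "h \<in> limit_space b" "limit_close b D' g h" for h
        using limit_close_trans[OF g that(1) _ D'(1) D(1) D'(3) D'(2) that(2)] D D'(1) that(1)
        unfolding U_def by blast
      then show ?case
        using elim by auto
    qed
  qed
  moreover have "f \<in> U"
    using assms by (auto simp: U_def)
  moreover have "limit_close b E f g" if "g \<in> U" for g
    using that limit_close_refl[of g b] by (auto simp: U_def)
  ultimately show ?thesis
    by (rule that)
qed

section \<open>Compact sets in the inverse limit\<close>

lemma finite_entourage_lower_bound:
  assumes "finite A" "\<And>x. x \<in> A \<Longrightarrow> entourage (D x)"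
  obtains E where "entourage E" "\<And>x. x \<in> A \<Longrightarrow> E \<subseteq> D x"
proof -
  have "\<exists>E. entourage E \<and> (\<forall>x\<in>A. E \<subseteq> D x)"
    using assms
  proof (induction A rule: finite_induct)
    case empty
    then show ?case using entourage_UNIV by auto
  next
    case (insert a A)
    then obtain E where "entourage E" "\<forall>x\<in>A. E \<subseteq> D x" by auto
    then show ?case
      using insert.prems by (intro exI[of _ "E \<inter> D a"]) (auto intro: entourage_Int)
  qed
  then show ?thesis using that by blast
qed

lemma continuous_limit_open_preimage:
  fixes g :: "'m::topological_space \<Rightarrow> ('a::uniform_space \<times> 'a) set \<Rightarrow> 'a list set"
  assumes "continuous_map (top_of_set K) (limit_topology b) g" "entourage E" "x \<in> K"
  obtains U where "open U" "x \<in> U" "\<And>y. y \<in> K \<inter> U \<Longrightarrow> limit_close b E (g x) (g y)"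
proof -
  have "g x \<in> limit_space b"
    using assms(1,3) by (auto simp: continuous_map_def topspace_limit_topology)
  then obtain V where V: "openin (limit_topology b) V" "g x \<in> V"
      "\<And>h. h \<in> V \<Longrightarrow> limit_close b E (g x) h"
    using assms(2) limit_close_neighbourhood by metis
  have "openin (top_of_set K) {y \<in> K. g y \<in> V}"
    using openin_continuous_map_preimage[OF assms(1) V(1)] by simp
  then obtain U where "open U" "{y \<in> K. g y \<in> V} = K \<inter> U"
    by (auto simp: openin_open)
  then show ?thesis
    using that[of U] V(2,3) assms(3) by blast
qed

lemma continuous_limit_uniformly_continuous:
  fixes g :: "'m::metric_space \<Rightarrow> ('a::uniform_space \<times> 'a) set \<Rightarrow> 'a list set"
  assumes K: "compact K" and g: "continuous_map (top_of_set K) (limit_topology b) g"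
    and E: "entourage E"
  obtains \<delta> where "\<delta> > 0"
    "\<And>x y. x \<in> K \<Longrightarrow> y \<in> K \<Longrightarrow> dist x y < \<delta> \<Longrightarrow> limit_close b E (g x) (g y)"
proof -
  have lim: "g x \<in> limit_space b" if "x \<in> K" for x
    using g that by (auto simp: continuous_map_def topspace_limit_topology)
  obtain D where D: "entourage D" "D O D \<subseteq> E" "D \<subseteq> E"
    using E by (rule entourage_half)
  have "\<exists>U. open U \<and> x \<in> U \<and> (\<forall>y \<in> K \<inter> U. limit_close b D (g x) (g y))" if "x \<in> K" for x
    using continuous_limit_open_preimage[OF g D(1) that] by metis
  then obtain U where U: "\<And>x. x \<in> K \<Longrightarrow> open (U x)" "\<And>x. x \<in> K \<Longrightarrow> x \<in> U x"
      "\<And>x y. x \<in> K \<Longrightarrow> y \<in> K \<Longrightarrow> y \<in> U x \<Longrightarrow> limit_close b D (g x) (g y)"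
    by (metis IntI)
  obtain \<delta> where \<delta>: "\<delta> > 0" "\<And>x. x \<in> K \<Longrightarrow> \<exists>G \<in> U ` K. ball x \<delta> \<subseteq> G"
    using Heine_Borel_lemma[OF K, of "U ` K"] U(1,2) by blast
  have "limit_close b E (g x) (g y)" if xy: "x \<in> K" "y \<in> K" "dist x y < \<delta>" for x y
  proof -
    obtain w where w: "w \<in> K" "ball x \<delta> \<subseteq> U w"
      using \<delta>(2)[OF xy(1)] by blast
    then have "x \<in> U w" "y \<in> U w"
      using xy(3) \<delta>(1) by auto
    then have "limit_close b D (g x) (g w)" "limit_close b D (g w) (g y)"
      using U(3) w(1) xy(1,2) limit_close_sym[OF D(1)] by blast+
    then show ?thesis
      using limit_close_trans[OF lim lim lim D(1) E D(3,2)] xy(1,2) w(1) by blast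
  qed
  with \<delta>(1) show ?thesis by (rule that)
qed

text \<open>The inverse of an embedding of a compact space is uniformly continuous, so already one stage
  \<open>X\<^sub>E\<close> of the limit separates points that are \<open>\<epsilon>\<close> apart.\<close>

lemma compact_embedding_separated_at_stage:
  fixes g :: "'m::metric_space \<Rightarrow> ('a::uniform_space \<times> 'a) set \<Rightarrow> 'a list set"
  assumes K: "compact K"
    and maps: "homeomorphic_maps (top_of_set K) (subtopology (limit_topology b) C) g h"
    and "\<epsilon> > 0"
  obtains E where "entourage E"
    "\<And>x y. x \<in> K \<Longrightarrow> y \<in> K \<Longrightarrow> limit_close b E (g x) (g y) \<Longrightarrow> dist x y < \<epsilon>"
proof -
  have g: "continuous_map (top_of_set K) (limit_topology b) g" and gC: "\<And>x. x \<in> K \<Longrightarrow> g x \<in> C"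
    using maps by (auto simp: homeomorphic_maps_def continuous_map_in_subtopology)
  have lim: "g x \<in> limit_space b" if "x \<in> K" for x
    using g that by (auto simp: continuous_map_def topspace_limit_topology)
  have h: "continuous_map (subtopology (limit_topology b) C) (top_of_set K) h"
    and hg: "\<And>x. x \<in> K \<Longrightarrow> h (g x) = x"
    using maps by (auto simp: homeomorphic_maps_def)
  have "\<exists>D U. entourage D \<and> open U \<and> x \<in> U \<and>
      (\<forall>y \<in> K \<inter> U. \<forall>z \<in> K. limit_close b D (g y) (g z) \<longrightarrow> dist y z < \<epsilon>)" if x: "x \<in> K" for x
  proof -
    \<comment> \<open>Continuity of the inverse \<open>h\<close> provides a neighbourhood of \<open>g x\<close> that meets the
      curve only near \<open>g x\<close>.\<close>
    have "openin (top_of_set K) (K \<inter> ball x (\<epsilon>/2))"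
      by (simp add: openin_open_Int)
    from openin_continuous_map_preimage[OF h this]
    obtain V where V: "openin (limit_topology b) V"
        "{f \<in> topspace (subtopology (limit_topology b) C). h f \<in> K \<inter> ball x (\<epsilon>/2)} = V \<inter> C"
      unfolding openin_subtopology by blast
    have V': "g y \<in> V \<longleftrightarrow> dist x y < \<epsilon>/2" if "y \<in> K" for y
    proof -
      have "g y \<in> V \<longleftrightarrow> g y \<in> V \<inter> C" using gC[OF that] by simp
      also have "\<dots> \<longleftrightarrow> dist x y < \<epsilon>/2"
        unfolding V(2)[symmetric] using that lim[OF that] gC[OF that] hg[OF that]
        by (simp add: topspace_limit_topology)
      finally show ?thesis .
    qed
    have "g x \<in> V" using V' x \<open>\<epsilon> > 0\<close> by simp
    then obtain E where E: "entourage E" "\<And>f. f \<in> limit_space b \<Longrightarrow> limit_close b E (g x) f \<Longrightarrow> f \<in> V"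
      using V(1) openin_limit_topologyE by metis
    obtain D where D: "entourage D" "D O D \<subseteq> E" "D \<subseteq> E"
      using E(1) by (rule entourage_half)
    obtain U where U: "open U" "x \<in> U" "\<And>y. y \<in> K \<inter> U \<Longrightarrow> limit_close b D (g x) (g y)"
      using continuous_limit_open_preimage[OF g D(1) x] by metis
    have "dist y z < \<epsilon>" if "y \<in> K \<inter> U" "z \<in> K" "limit_close b D (g y) (g z)" for y z
    proof -
      have "limit_close b E (g x) (g z)" "limit_close b E (g x) (g y)"
        using limit_close_trans[OF lim lim lim D(1) E(1) D(3,2) U(3)] that x
          limit_close_mono[OF lim lim D(1) E(1) D(3) U(3)] by blast+
      then have "dist x z < \<epsilon>/2" "dist x y < \<epsilon>/2"
        using E(2) lim V' that by auto
      then show ?thesis by (smt (verit) dist_commute dist_triangle_half_l)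
    qed
    then show ?thesis using D(1) U(1,2) by blast
  qed
  then obtain D U where DU: "\<And>x. x \<in> K \<Longrightarrow> entourage (D x)" "\<And>x. x \<in> K \<Longrightarrow> open (U x)"
      "\<And>x. x \<in> K \<Longrightarrow> x \<in> U x"
      "\<And>x y z. x \<in> K \<Longrightarrow> y \<in> K \<inter> U x \<Longrightarrow> z \<in> K \<Longrightarrow> limit_close b (D x) (g y) (g z) \<Longrightarrow> dist y z < \<epsilon>"
    by metis
  obtain A where A: "A \<subseteq> K" "finite A" "K \<subseteq> (\<Union>x\<in>A. U x)"
    using compactE_image[OF K, of K U] DU(2,3) by blast
  obtain E where E: "entourage E" "\<And>x. x \<in> A \<Longrightarrow> E \<subseteq> D x"
    using finite_entourage_lower_bound[OF A(2), of D] DU(1) A(1) by blast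
  have "dist y z < \<epsilon>" if yz: "y \<in> K" "z \<in> K" "limit_close b E (g y) (g z)" for y z
  proof -
    obtain x where "x \<in> A" "y \<in> U x" using A(3) yz(1) by blast
    moreover have "limit_close b (D x) (g y) (g z)"
      using limit_close_mono[OF lim lim E(1) DU(1) E(2)] yz \<open>x \<in> A\<close> A(1) by blast
    ultimately show ?thesis using DU(4) yz A(1) by blast
  qed
  with E(1) show ?thesis by (rule that)
qed

section \<open>Angles between points of the circle\<close>

text \<open>For close points of the unit circle this is twice the oriented angle from \<open>x\<close> to \<open>y\<close>. Taking the
  difference of both arguments makes it antisymmetric for all pairs, including antipodal points,
  where \<open>Arg\<close> itself is not.\<close>

definition double_angle :: "complex \<Rightarrow> complex \<Rightarrow> real" where
  "double_angle x y = Arg (y / x) - Arg (x / y)"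

lemma double_angle_antisym: "double_angle y x = - double_angle x y"
  by (simp add: double_angle_def)

lemma Arg_divide_add:
  assumes "norm x = 1" "norm y = 1" "norm z = 1" "dist x y < 1" "dist y z < 1"
    "dist x z < 1"
  shows "Arg (z / x) = Arg (y / x) + Arg (z / y)"
proof -
  have half: "\<bar>Arg (v / u)\<bar> < pi / 2" if "norm u = 1" "norm v = 1" "dist u v < 1" for u v :: complex
  proof -
    have nz: "u \<noteq> 0" "v \<noteq> 0" using that by auto
    have "v / u - 1 = (v - u) / u" using nz by (simp add: field_simps)
    then have "norm (v / u - 1) < 1"
      using that by (simp add: norm_divide dist_norm norm_minus_commute)
    then have "0 < Re (v / u)"
      using abs_Re_le_cmod[of "v / u - 1"] by simp
    then show ?thesis
      using nz Re_Ln_pos_lt[of "v / u"] by (simp add: Arg_eq_Im_Ln)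
  qed
  have nz: "x \<noteq> 0" "y \<noteq> 0" "z \<noteq> 0" using assms by auto
  have "Arg (y / x * (z / y)) = Arg (y / x) + Arg (z / y)"
    using half[of x y] half[of y z] assms nz by (intro Arg_times) auto
  then show ?thesis using nz by simp
qed

lemma double_angle_add:
  assumes "norm x = 1" "norm y = 1" "norm z = 1" "dist x y < 1" "dist y z < 1" "dist x z < 1"
  shows "double_angle x z = double_angle x y + double_angle y z"
  using Arg_divide_add[of x y z] Arg_divide_add[of z y x] assms
  by (simp add: double_angle_def dist_commute)

lemma double_angle_cis:
  assumes "0 < t" "t < pi"
  shows "double_angle (cis s) (cis (s + t)) = 2 * t"
proof -
  have "cis (s + t) / cis s = cis t" "cis s / cis (s + t) = cis (- t)"
    by (simp_all add: cis_divide)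
  then show ?thesis
    using assms by (simp add: double_angle_def Arg_cis)
qed

section \<open>Cocycles from covers of order two\<close>

text \<open>If \<open>u\<close> and \<open>v\<close> lie in two different members \<open>Q\<close> and \<open>Q'\<close>, then \<open>\<sigma> u\<close> and \<open>\<sigma> v\<close> belong to \<open>{Q, Q'}\<close>,
  and antisymmetry of \<open>c\<close> makes the detours through \<open>Q\<close> and through \<open>Q'\<close> agree. In the nerve, which is
  a graph, both detours are the same path up to backtracking.\<close>

lemma order_two_cocycle:
  fixes c :: "'p set \<Rightarrow> 'p set \<Rightarrow> real" and \<sigma> :: "'p \<Rightarrow> 'p set"
  assumes order: "\<And>u P Q R. P \<in> \<W> \<Longrightarrow> Q \<in> \<W> \<Longrightarrow> R \<in> \<W> \<Longrightarrow> u \<in> P \<Longrightarrow> u \<in> Q \<Longrightarrow> u \<in> R \<Longrightarrow>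
      P = Q \<or> P = R \<or> Q = R"
    and antisym: "\<And>P Q. c P Q = - c Q P"
    and \<sigma>: "\<And>u Q. Q \<in> \<W> \<Longrightarrow> u \<in> Q \<Longrightarrow> \<sigma> u \<in> \<W> \<and> u \<in> \<sigma> u"
  shows "\<exists>d. \<forall>Q\<in>\<W>. \<forall>u\<in>Q. \<forall>v\<in>Q. d u v = c (\<sigma> u) Q + c Q (\<sigma> v)"
proof -
  define d where "d u v = (let Q = SOME Q. Q \<in> \<W> \<and> u \<in> Q \<and> v \<in> Q in c (\<sigma> u) Q + c Q (\<sigma> v))" for u v
  have "d u v = c (\<sigma> u) Q + c Q (\<sigma> v)" if Q: "Q \<in> \<W>" "u \<in> Q" "v \<in> Q" for Q u v
  proof -
    define Q' where "Q' = (SOME Q. Q \<in> \<W> \<and> u \<in> Q \<and> v \<in> Q)"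
    have Q': "Q' \<in> \<W> \<and> u \<in> Q' \<and> v \<in> Q'"
      unfolding Q'_def by (rule someI[of _ Q]) (use Q in blast)
    have d: "d u v = c (\<sigma> u) Q' + c Q' (\<sigma> v)"
      by (simp add: d_def Q'_def Let_def)
    show ?thesis
    proof (cases "Q = Q'")
      case False
      then have "\<sigma> u \<in> {Q, Q'}" "\<sigma> v \<in> {Q, Q'}"
        using order[of Q Q' "\<sigma> u" u] order[of Q Q' "\<sigma> v" v] Q Q' \<sigma> by auto
      then show ?thesis
        using d antisym[of Q Q] antisym[of Q' Q'] antisym[of Q Q'] by auto
    qed (simp add: d)
  qed
  then show ?thesis by blast
qed

text \<open>Pull the angle on the circle back along \<open>\<gamma>\<close>: each member \<open>P\<close> of the cover that meets the curve is represented by a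
  point \<open>r P\<close> of the circle that \<open>\<gamma>\<close> sends into \<open>P\<close>. Since members have small preimages, the
  resulting cocycle differs on the curve from the angle by the coboundary of
  \<open>x \<mapsto> double_angle x (r (\<sigma> (\<gamma> x)))\<close>.\<close>

lemma angle_cocycle:
  fixes \<gamma> :: "complex \<Rightarrow> 'p"
  assumes order: "\<And>u P Q R. P \<in> \<W> \<Longrightarrow> Q \<in> \<W> \<Longrightarrow> R \<in> \<W> \<Longrightarrow> u \<in> P \<Longrightarrow> u \<in> Q \<Longrightarrow> u \<in> R \<Longrightarrow>
      P = Q \<or> P = R \<or> Q = R"
    and small: "\<And>Q x y. Q \<in> \<W> \<Longrightarrow> norm x = 1 \<Longrightarrow> norm y = 1 \<Longrightarrow> \<gamma> x \<in> Q \<Longrightarrow> \<gamma> y \<in> Q \<Longrightarrow>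
      dist x y < 1/3"
  shows "\<exists>(d :: 'p \<Rightarrow> 'p \<Rightarrow> real) (h :: complex \<Rightarrow> real). \<forall>Q\<in>\<W>.
    (\<forall>u\<in>Q. \<forall>v\<in>Q. \<forall>w\<in>Q. d u w = d u v + d v w) \<and>
    (\<forall>x y. norm x = 1 \<longrightarrow> norm y = 1 \<longrightarrow> \<gamma> x \<in> Q \<longrightarrow> \<gamma> y \<in> Q \<longrightarrow>
      d (\<gamma> x) (\<gamma> y) = double_angle x y + h y - h x)"
proof -
  define r where "r P = (SOME x. norm x = 1 \<and> \<gamma> x \<in> P)" for P
  have r: "norm (r P) = 1 \<and> \<gamma> (r P) \<in> P" if "norm x = 1" "\<gamma> x \<in> P" for P x
    unfolding r_def by (rule someI[of _ x]) (use that in blast)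
  define \<sigma> where "\<sigma> u = (SOME P. P \<in> \<W> \<and> u \<in> P)" for u
  have \<sigma>: "\<sigma> u \<in> \<W> \<and> u \<in> \<sigma> u" if "Q \<in> \<W>" "u \<in> Q" for Q u
    unfolding \<sigma>_def by (rule someI[of _ Q]) (use that in blast)
  define c where "c P Q = double_angle (r P) (r Q)" for P Q
  have antisym: "c P Q = - c Q P" for P Q
    unfolding c_def by (rule double_angle_antisym)
  have "\<exists>d. \<forall>Q\<in>\<W>. \<forall>u\<in>Q. \<forall>v\<in>Q. d u v = c (\<sigma> u) Q + c Q (\<sigma> v)"
    using order antisym \<sigma> by (rule order_two_cocycle)
  then obtain d where d: "\<And>Q u v. Q \<in> \<W> \<Longrightarrow> u \<in> Q \<Longrightarrow> v \<in> Q \<Longrightarrow> d u v = c (\<sigma> u) Q + c Q (\<sigma> v)"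
    by blast
  define h where "h x = double_angle x (r (\<sigma> (\<gamma> x)))" for x
  have "d u w = d u v + d v w" if "Q \<in> \<W>" "u \<in> Q" "v \<in> Q" "w \<in> Q" for Q u v w
    using d that antisym[of "\<sigma> v" Q] by simp
  moreover have "d (\<gamma> x) (\<gamma> y) = double_angle x y + h y - h x"
    if Q: "Q \<in> \<W>" and xy: "norm x = 1" "norm y = 1" "\<gamma> x \<in> Q" "\<gamma> y \<in> Q" for Q x y
  proof -
    \<comment> \<open>The representatives of the three sheets involved lie within \<open>1/3\<close> of \<open>x\<close> or \<open>y\<close>, so all
      the angles that occur are small enough to be additive.\<close>
    define p q s where "p = r (\<sigma> (\<gamma> x))" and "q = r Q" and "s = r (\<sigma> (\<gamma> y))"
    have n: "norm p = 1" "norm q = 1" "norm s = 1"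
      using r \<sigma>[OF Q] xy unfolding p_def q_def s_def by blast+
    have px: "dist p x < 1/3" and sy: "dist s y < 1/3"
      using small r \<sigma>[OF Q] xy unfolding p_def s_def by blast+
    have qx: "dist q x < 1/3" and qy: "dist q y < 1/3" and "dist x y < 1/3"
      using small[OF Q] r xy unfolding q_def by blast+
    then have dists: "dist p q < 1" "dist q s < 1" "dist p s < 1" "dist p y < 1" "dist p x < 1"
        "dist x y < 1" "dist y s < 1"
      using px sy dist_triangle[of p q x] dist_triangle[of q s y] dist_triangle[of p y x]
        dist_triangle[of p s y] by (simp_all add: dist_commute)
    have "d (\<gamma> x) (\<gamma> y) = double_angle p q + double_angle q s"
      using d[OF Q xy(3,4)] by (simp add: c_def p_def q_def s_def)
    also have "\<dots> = double_angle p s"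
      using double_angle_add[of p q s] n dists by simp
    also have "\<dots> = double_angle p y + double_angle y s"
      using double_angle_add[of p y s] n xy dists by simp
    also have "double_angle p y = double_angle p x + double_angle x y"
      using double_angle_add[of p x y] n xy dists by simp
    finally show ?thesis
      using double_angle_antisym[of p x] by (simp add: h_def p_def s_def)
  qed
  ultimately show ?thesis by blast
qed

section \<open>Lifting a cover to the space of chain classes\<close>

text \<open>For an \<open>E\<close>-small set \<open>V\<close> and a chain \<open>\<alpha>\<close> that ends in \<open>V\<close>, this is the lift of \<open>V\<close> to \<open>X\<^sub>E\<close> that
  contains the class of \<open>\<alpha>\<close>.\<close>

definition sheet :: "('a \<times> 'a) set \<Rightarrow> 'a list \<Rightarrow> 'a set \<Rightarrow> 'a list set set" where
  "sheet E \<alpha> V = (\<lambda>z. echain_class E (\<alpha> @ [z])) ` V"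

definition sheets :: "'a \<Rightarrow> ('a \<times> 'a) set \<Rightarrow> 'a set set \<Rightarrow> 'a list set set set" where
  "sheets b E \<V> = {sheet E \<alpha> V |\<alpha> V q. V \<in> \<V> \<and> echain E b q \<alpha> \<and> q \<in> V}"

text \<open>Inside an \<open>E\<close>-small set every triangle can be cut short, so a sheet is determined by the set and
  by any one of the classes in it: lifts of the same set are equal or disjoint.\<close>

lemma sheet_eq_if_member:
  assumes V: "V \<times> V \<subseteq> E" and \<alpha>: "echain E b q \<alpha>" "q \<in> V" and "echain_class E \<beta> \<in> sheet E \<alpha> V"
  shows "last \<beta> \<in> V" "sheet E \<alpha> V = sheet E \<beta> V"
proof -
  obtain z where z: "z \<in> V" "echain_class E \<beta> = echain_class E (\<alpha> @ [z])"
    using assms(4) by (auto simp: sheet_def)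
  then have last: "last \<beta> = z"
    using echain_class_eq_last[OF z(2)] by simp
  with z show "last \<beta> \<in> V" by simp
  have "echain_class E (\<beta> @ [w]) = echain_class E (\<alpha> @ [w])" if "w \<in> V" for w
  proof -
    have *: "(q, z) \<in> E" "(z, w) \<in> E" "(q, w) \<in> E"
      using V \<alpha>(2) z(1) that by blast+
    have "echain_class E (\<beta> @ [w]) = echain_class E ((\<alpha> @ [z]) @ [w])"
      using z(2) last * by (intro echain_class_snoc_cong) auto
    also have "\<dots> = echain_class E (\<alpha> @ [w])"
      using echain_class_shortcut[OF \<alpha>(1)] * by simp
    finally show ?thesis .
  qed
  then show "sheet E \<alpha> V = sheet E \<beta> V"
    by (simp add: sheet_def)
qed

text \<open>By the uniqueness of lifts, the sheets through a class correspond to the members of the cover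
  that contain its endpoint.\<close>

lemma sheets_order_two:
  assumes order: "cover_order_le \<V> 2" and small: "\<And>V. V \<in> \<V> \<Longrightarrow> V \<times> V \<subseteq> E"
    and PQR: "P \<in> sheets b E \<V>" "Q \<in> sheets b E \<V>" "R \<in> sheets b E \<V>" "u \<in> P" "u \<in> Q" "u \<in> R"
  shows "P = Q \<or> P = R \<or> Q = R"
proof -
  obtain \<beta> where \<beta>: "u = echain_class E \<beta>"
    using PQR(1,4) by (auto simp: sheets_def sheet_def)
  have "\<exists>V. V \<in> \<V> \<and> last \<beta> \<in> V \<and> S = sheet E \<beta> V" if S: "S \<in> sheets b E \<V>" "u \<in> S" for S
  proof -
    obtain \<alpha> V q where \<alpha>: "S = sheet E \<alpha> V" "V \<in> \<V>" "echain E b q \<alpha>" "q \<in> V"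
      using S(1) by (auto simp: sheets_def)
    from sheet_eq_if_member[OF small[OF \<alpha>(2)] \<alpha>(3,4)] S(2) \<alpha>(1,2) \<beta> show ?thesis
      by auto
  qed
  from this[OF PQR(1,4)] this[OF PQR(2,5)] this[OF PQR(3,6)]
  obtain V1 V2 V3 where V:
      "V1 \<in> \<V>" "V2 \<in> \<V>" "V3 \<in> \<V>"
      "last \<beta> \<in> V1" "last \<beta> \<in> V2" "last \<beta> \<in> V3"
      "P = sheet E \<beta> V1" "Q = sheet E \<beta> V2" "R = sheet E \<beta> V3"
    by auto
  have "card {V1, V2, V3} \<le> card {V \<in> \<V>. last \<beta> \<in> V}"
    using order V unfolding cover_order_le_def by (intro card_mono) auto
  also have "\<dots> \<le> 2"
    using order unfolding cover_order_le_def by blast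
  finally have "V1 = V2 \<or> V1 = V3 \<or> V2 = V3"
    by (auto simp: card_insert_if split: if_splits)
  then show ?thesis using V by auto
qed

lemma sheet_members_close:
  assumes "entourage E" "\<And>V. V \<in> \<V> \<Longrightarrow> V \<times> V \<subseteq> E" "S \<in> sheets b E \<V>" "u \<in> S" "v \<in> S"
  shows "(u, v) \<in> star b E E"
proof -
  obtain \<alpha> V q where \<alpha>: "S = sheet E \<alpha> V" "V \<in> \<V>" "echain E b q \<alpha>" "q \<in> V"
    using assms(3) by (auto simp: sheets_def)
  then obtain y z where yz: "y \<in> V" "z \<in> V" "u = echain_class E (\<alpha> @ [y])" "v = echain_class E (\<alpha> @ [z])"
    using assms(4,5) by (auto simp: sheet_def)
  have "echain E b y (\<alpha> @ [y])" "echain E b z (\<alpha> @ [z])" "(y, z) \<in> E" "\<alpha> \<noteq> []"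
    using \<alpha> yz assms(2)[OF \<alpha>(2)] by (auto simp: echain_snoc_iff echain_last echain_not_Nil)
  then show ?thesis
    using yz unfolding star_def by blast
qed

text \<open>A member of the cover that contains the \<open>F\<close>-ball around \<open>q\<close> lifts to a sheet through \<open>\<alpha>\<close> that
  contains all one-step \<open>F\<close>-extensions of \<open>\<alpha>\<close>.\<close>

lemma common_sheet:
  assumes E: "entourage E" and F: "refines (range (entourage_ball F)) \<V>" "(q, q) \<in> F"
    and \<alpha>: "echain E b q \<alpha>" and yz: "(q, y) \<in> F" "(q, z) \<in> F"
  obtains S where "S \<in> sheets b E \<V>" "echain_class E \<alpha> \<in> S" "echain_class E (\<alpha> @ [y]) \<in> S"
    "echain_class E (\<alpha> @ [z]) \<in> S"
proof -
  obtain V where V: "V \<in> \<V>" "entourage_ball F q \<subseteq> V"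
    using F(1) by (auto simp: refines_def)
  then have "q \<in> V" "y \<in> V" "z \<in> V"
    using F(2) yz by (auto simp: entourage_ball_def)
  moreover from this V(1) \<alpha> have "sheet E \<alpha> V \<in> sheets b E \<V>"
    by (auto simp: sheets_def)
  moreover have "echain_class E \<alpha> = echain_class E (\<alpha> @ [q])"
    using echain_class_repeat_last[OF \<alpha>] entourage_refl[OF E] by simp
  ultimately show ?thesis
    using that[of "sheet E \<alpha> V"] by (auto simp: sheet_def)
qed

section \<open>Summing a cocycle along a lifted chain\<close>

text \<open>The prefixes of \<open>\<alpha>\<close> trace out the lift of \<open>\<alpha>\<close> to \<open>X\<^sub>E\<close>. The term for \<open>i = 0\<close>, which involves the
  empty prefix, is the same for all chains that start at the base point and cancels.\<close>

definition lifted_sum :: "('a \<times> 'a) set \<Rightarrow> ('a list set \<Rightarrow> 'a list set \<Rightarrow> real) \<Rightarrow> 'a list \<Rightarrow> real" where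
  "lifted_sum E d \<alpha> =
     (\<Sum>i<length \<alpha>. d (echain_class E (take i \<alpha>)) (echain_class E (take (Suc i) \<alpha>)))"

lemma lifted_sum_snoc:
  "lifted_sum E d (\<alpha> @ [z]) = lifted_sum E d \<alpha> + d (echain_class E \<alpha>) (echain_class E (\<alpha> @ [z]))"
  by (simp add: lifted_sum_def)

text \<open>Inserting a point replaces one side of an \<open>F\<close>-triangle in the lift by the other two, which
  preserves the sum, and leaves the rest of the lift unchanged.\<close>

lemma lifted_sum_homotopic:
  assumes F: "entourage F" "F \<subseteq> E"
    and d: "\<And>\<alpha> q y z. echain F b q \<alpha> \<Longrightarrow> (q, y) \<in> F \<Longrightarrow> (q, z) \<in> F \<Longrightarrow> (y, z) \<in> F \<Longrightarrow>
      d (echain_class E \<alpha>) (echain_class E (\<alpha> @ [z])) =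
      d (echain_class E \<alpha>) (echain_class E (\<alpha> @ [y])) +
      d (echain_class E (\<alpha> @ [y])) (echain_class E (\<alpha> @ [z]))"
    and hom: "echain_homotopic F \<alpha> \<beta>" and \<alpha>: "hd \<alpha> = b"
  shows "lifted_sum E d \<alpha> = lifted_sum E d \<beta>"
proof -
  let ?c = "echain_class E"
  have refl: "(q, q) \<in> F" for q using F(1) by (rule entourage_refl)
  have stay: "?c (\<alpha> @ [q]) = ?c \<alpha> \<and> d (?c \<alpha>) (?c \<alpha>) = 0" if "echain F b q \<alpha>" for \<alpha> q
  proof -
    \<comment> \<open>The degenerate triangle at \<open>q\<close> gives \<open>d u u = d u u + d u u\<close>.\<close>
    have eq: "?c (\<alpha> @ [q]) = ?c \<alpha>"
      using echain_class_repeat_last[OF echain_mono[OF that F(2)]] refl F(2) by blast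
    show ?thesis using d[OF that refl refl refl] eq unfolding eq by simp
  qed
  have ins: "?c (xs @ x # ys) = ?c (xs @ ys) \<and> lifted_sum E d (xs @ x # ys) = lifted_sum E d (xs @ ys)"
    if "echain F b q (xs @ ys)" "echain F b q (xs @ x # ys)" for xs x ys q
    using that
  proof (induction ys arbitrary: q rule: rev_induct)
    case Nil
    then have "echain F b x xs" by (auto simp: echain_def)
    from stay[OF this] show ?case by (simp add: lifted_sum_snoc)
  next
    case (snoc z ys)
    have ch: "echain F b q ((xs @ ys) @ [z])" "echain F b q ((xs @ x # ys) @ [z])"
      using snoc.prems by simp_all
    have split: "xs @ ys @ [z] = (xs @ ys) @ [z]" "xs @ x # ys @ [z] = (xs @ x # ys) @ [z]" by simp_all
    show ?case
    proof (cases "ys = []")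
      case False
      then have "echain F b (last ys) (xs @ ys)" "echain F b (last ys) (xs @ x # ys)" "(last ys, z) \<in> F"
        using ch unfolding echain_snoc_iff by auto
      note pre = this
      note IH = snoc.IH[OF pre(1,2)]
      have "?c ((xs @ x # ys) @ [z]) = ?c ((xs @ ys) @ [z])"
        using IH pre(3) F(2) False by (intro echain_class_snoc_cong) auto
      then show ?thesis
        unfolding split lifted_sum_snoc using IH by simp
    next
      case ys: True
      show ?thesis
      proof (cases "xs = []")
        \<comment> \<open>A point inserted in front of the chain must be the base point.\<close>
        case True
        then have "x = b" "z = b" using ch ys by (auto simp: echain_def)
        moreover have "echain F b b [b]" by (simp add: echain_def)
        ultimately show ?thesis
          using stay[of b "[b]"] lifted_sum_snoc[of E d "[b]" b] True ys by simp
      next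
        case False
        define p where "p = last xs"
        have "echain F b q ((xs @ [x]) @ [z])" "echain F b q (xs @ [z])"
          using ch ys by simp_all
        then have p: "echain F b p xs" "(p, x) \<in> F" "(x, z) \<in> F" "(p, z) \<in> F"
          using False unfolding echain_snoc_iff p_def by auto
        have "?c (xs @ [x, z]) = ?c (xs @ [z])"
          using p F(2) by (intro echain_class_shortcut[OF echain_mono[OF p(1) F(2)]]) auto
        then show ?thesis
          using d[OF p(1,2,4,3)] lifted_sum_snoc[of E d "xs @ [x]" z] ys
          by (simp add: lifted_sum_snoc)
      qed
    qed
  qed
  have insert: "lifted_sum E d \<beta> = lifted_sum E d \<gamma> \<and> hd \<beta> = hd \<gamma>"
    if \<beta>\<gamma>: "echain_insert F \<beta> \<gamma>" and hd: "hd \<beta> = b \<or> hd \<gamma> = b" for \<beta> \<gamma>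
  proof -
    obtain p q where "echain F p q \<beta>" "echain F p q \<gamma>"
      using \<beta>\<gamma> unfolding echain_insert_def by blast
    moreover obtain xs x ys where "\<beta> = xs @ ys" "\<gamma> = xs @ x # ys"
      using \<beta>\<gamma> unfolding echain_insert_def by blast
    moreover from calculation(1,2) hd have "p = b" "hd \<beta> = hd \<gamma>" unfolding echain_def by auto
    ultimately show ?thesis using ins by metis
  qed
  from hom have "lifted_sum E d \<alpha> = lifted_sum E d \<beta> \<and> hd \<beta> = b"
    unfolding echain_homotopic_def
  proof (induction rule: equivclp_induct)
    case (step \<beta> \<gamma>)
    then show ?case using insert by metis
  qed (simp add: \<alpha>)
  then show ?thesis ..
qed

text \<open>Close classes differ by one appended point, so representatives can be chosen successively, each
  extending the one before.\<close>

lemma chain_along_limit_sequence: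
  assumes F: "entourage F" and lim: "\<And>i. f i \<in> limit_space b"
    and close: "\<And>i. limit_close b F (f i) (f (Suc i))"
  obtains \<alpha> q where "\<And>i. echain F b (q i) (\<alpha> i)" "\<And>i. f i F = echain_class F (\<alpha> i)"
    "\<And>i. (q i, q (Suc i)) \<in> F" "\<And>i. \<alpha> (Suc i) = \<alpha> i @ [q (Suc i)]"
proof -
  obtain \<alpha>0 q0 where \<alpha>0: "echain F b q0 \<alpha>0" "f 0 F = echain_class F \<alpha>0"
    by (rule limit_space_component[OF lim[of 0] F])
  have "\<exists>\<beta>. \<forall>i. (echain F b (last (\<beta> i)) (\<beta> i) \<and> f i F = echain_class F (\<beta> i)) \<and>
      (\<exists>z. (last (\<beta> i), z) \<in> F \<and> \<beta> (Suc i) = \<beta> i @ [z])"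
  proof (rule dependent_nat_choice[where
        P = "\<lambda>i \<beta>. echain F b (last \<beta>) \<beta> \<and> f i F = echain_class F \<beta>" and
        Q = "\<lambda>i \<beta> \<gamma>. \<exists>z. (last \<beta>, z) \<in> F \<and> \<gamma> = \<beta> @ [z]"])
    show "\<exists>\<beta>. echain F b (last \<beta>) \<beta> \<and> f 0 F = echain_class F \<beta>"
      using \<alpha>0 echain_last[OF \<alpha>0(1)] by auto
    fix \<beta> i assume \<beta>: "echain F b (last \<beta>) \<beta> \<and> f i F = echain_class F \<beta>"
    then obtain z where z: "(last \<beta>, z) \<in> F" "f (Suc i) F = echain_class F (\<beta> @ [z])"
      using star_extend[of F \<beta> "f (Suc i) F" b F] close[of i] by (auto simp: limit_close_def)
    with \<beta> have "echain F b (last (\<beta> @ [z])) (\<beta> @ [z])"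
      by (auto simp: echain_snoc_iff dest: echain_not_Nil)
    with z show "\<exists>\<gamma>. (echain F b (last \<gamma>) \<gamma> \<and> f (Suc i) F = echain_class F \<gamma>) \<and>
        (\<exists>z. (last \<beta>, z) \<in> F \<and> \<gamma> = \<beta> @ [z])"
      by blast
  qed
  then obtain \<beta> where \<beta>: "\<And>i. echain F b (last (\<beta> i)) (\<beta> i)" "\<And>i. f i F = echain_class F (\<beta> i)"
      "\<And>i. \<exists>z. (last (\<beta> i), z) \<in> F \<and> \<beta> (Suc i) = \<beta> i @ [z]"
    by metis
  have "(last (\<beta> i), last (\<beta> (Suc i))) \<in> F" "\<beta> (Suc i) = \<beta> i @ [last (\<beta> (Suc i))]" for i
    using \<beta>(3)[of i] by auto
  with \<beta>(1,2) show ?thesis by (rule that[of "\<lambda>i. last (\<beta> i)" \<beta>])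
qed

lemma fine_regular_polygon:
  assumes "\<delta> > 0"
  obtains N :: nat and t :: real where "0 < t" "t < pi" "N * t = 2 * pi"
    "\<And>s. dist (cis s) (cis (s + t)) < \<delta>"
proof -
  have "(\<lambda>n. cis (2 * pi / real n)) \<longlonglongrightarrow> cis 0"
    by (intro tendsto_intros tendsto_divide_0[OF tendsto_const]
        filterlim_at_top_imp_at_infinity filterlim_real_sequentially)
  then have "eventually (\<lambda>n. dist (cis (2 * pi / real n)) 1 < \<delta>) sequentially"
    using assms by (auto simp: tendsto_iff)
  then have "eventually (\<lambda>n. dist (cis (2 * pi / real n)) 1 < \<delta> \<and> n \<ge> 3) sequentially"
    by (intro eventually_conj eventually_ge_at_top)
  then obtain N where N: "dist (cis (2 * pi / real N)) 1 < \<delta>" "N \<ge> 3"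
    using eventually_happens'[OF sequentially_bot] by blast
  define t where "t = 2 * pi / real N"
  have "0 < t" "t < pi" "N * t = 2 * pi"
    using N(2) by (auto simp: t_def field_simps)
  moreover have "dist (cis s) (cis (s + t)) < \<delta>" for s
  proof -
    have "cis s - cis (s + t) = cis s * (1 - cis t)"
      by (simp add: cis_mult algebra_simps)
    then have "dist (cis s) (cis (s + t)) = dist (cis t) 1"
      by (simp add: dist_norm norm_mult norm_minus_commute)
    then show ?thesis using N(1) by (simp add: t_def)
  qed
  ultimately show ?thesis by (rule that[of t N])
qed

section \<open>Circles in the inverse limit\<close>

theorem proposition89:
  fixes b :: "'a::uniform_space"
  assumes "coverable b"
    and "udim_le TYPE('a) 1"
  shows "\<not> (\<exists>C. simple_closed_curve_in (limit_topology b) C)"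
proof
  assume "\<exists>C. simple_closed_curve_in (limit_topology b) C"
  then obtain C g h where
    maps: "homeomorphic_maps (top_of_set (sphere (0::complex) 1)) (subtopology (limit_topology b) C) g h"
    unfolding simple_closed_curve_in_def
    by (meson homeomorphic_space_def homeomorphic_space_sym)
  then have g: "continuous_map (top_of_set (sphere 0 1)) (limit_topology b) g"
    by (auto simp: homeomorphic_maps_def continuous_map_in_subtopology)
  then have lim: "g x \<in> limit_space b" if "norm x = 1" for x
    using that by (auto simp: continuous_map_def topspace_limit_topology)
  obtain E where E: "entourage E"
    and sep: "\<And>x y. norm x = 1 \<Longrightarrow> norm y = 1 \<Longrightarrow> limit_close b E (g x) (g y) \<Longrightarrow> dist x y < 1/3"
    using compact_embedding_separated_at_stage[OF compact_sphere maps, of "1/3"] by auto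
  obtain \<U> :: "'a set set" where \<U>: "uniform_open_cover \<U>" "\<And>U. U \<in> \<U> \<Longrightarrow> U \<times> U \<subseteq> E"
    using small_uniform_open_cover[OF E] by metis
  obtain \<V> where \<V>: "uniform_open_cover \<V>" "refines \<V> \<U>" "cover_order_le \<V> 2"
    using assms(2)[unfolded udim_le_def one_add_one, rule_format, OF \<U>(1)] by blast
  have small: "V \<times> V \<subseteq> E" if V: "V \<in> \<V>" for V
  proof -
    obtain U where "U \<in> \<U>" "V \<subseteq> U"
      using \<V>(2) V by (auto simp: refines_def)
    then show ?thesis
      using \<U>(2)[of U] by blast
  qed
  obtain F where F: "entourage F" "refines (range (entourage_ball F)) \<V>"
    using \<V>(1) unfolding uniform_open_cover_def by blast
  \<comment> \<open>A point lies in its own ball, so the two points of a pair in \<open>F\<close> share an \<open>E\<close>-small set.\<close>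
  have FE: "F \<subseteq> E"
  proof
    fix p assume p: "p \<in> F"
    obtain V where "V \<in> \<V>" "entourage_ball F (fst p) \<subseteq> V"
      using F(2) by (auto simp: refines_def)
    then have "fst p \<in> V" "snd p \<in> V" "V \<times> V \<subseteq> E"
      using p entourage_refl[OF F(1)] small by (auto simp: entourage_ball_def)
    then show "p \<in> E" by (cases p) auto
  qed
  have sheet_small: "dist x y < 1/3"
    if "S \<in> sheets b E \<V>" "norm x = 1" "norm y = 1" "g x E \<in> S" "g y E \<in> S" for S x y
    using sep[OF that(2,3)] sheet_members_close[OF E small that(1,4,5)]
    by (simp add: limit_close_def)
  have order: "P = Q \<or> P = R \<or> Q = R"
    if "P \<in> sheets b E \<V>" "Q \<in> sheets b E \<V>" "R \<in> sheets b E \<V>" "u \<in> P" "u \<in> Q" "u \<in> R"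
    for u P Q R
    using \<V>(3) small that by (rule sheets_order_two)
  have "\<exists>d k. \<forall>S\<in>sheets b E \<V>.
      (\<forall>u\<in>S. \<forall>v\<in>S. \<forall>w\<in>S. d u w = d u v + d v w) \<and>
      (\<forall>x y. norm x = 1 \<longrightarrow> norm y = 1 \<longrightarrow> g x E \<in> S \<longrightarrow> g y E \<in> S \<longrightarrow>
        d (g x E) (g y E) = double_angle x y + k y - k x)"
    by (rule angle_cocycle[where \<gamma> = "\<lambda>x. g x E"]) (fact order, fact sheet_small)
  then obtain d k where dk: "\<forall>S\<in>sheets b E \<V>.
      (\<forall>u\<in>S. \<forall>v\<in>S. \<forall>w\<in>S. d u w = d u v + d v w) \<and>
      (\<forall>x y. norm x = 1 \<longrightarrow> norm y = 1 \<longrightarrow> g x E \<in> S \<longrightarrow> g y E \<in> S \<longrightarrow>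
        d (g x E) (g y E) = double_angle x y + k y - k x)"
    by (elim exE)
  have d: "d u w = d u v + d v w"
    if "S \<in> sheets b E \<V>" "u \<in> S" "v \<in> S" "w \<in> S" for S u v w
    by (rule bspec[OF dk that(1), THEN conjunct1, rule_format, OF that(2-4)])
  have dg: "d (g x E) (g y E) = double_angle x y + k y - k x"
    if "S \<in> sheets b E \<V>" "norm x = 1" "norm y = 1" "g x E \<in> S" "g y E \<in> S" for S x y
    by (rule bspec[OF dk that(1), THEN conjunct2, rule_format, OF that(2-5)])
  obtain \<delta> where \<delta>: "\<delta> > 0"
      "\<And>x y. norm x = 1 \<Longrightarrow> norm y = 1 \<Longrightarrow> dist x y < \<delta> \<Longrightarrow> limit_close b F (g x) (g y)"
    using continuous_limit_uniformly_continuous[OF compact_sphere g F(1)] by auto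
  obtain N :: nat and t :: real where t: "0 < t" "t < pi" "N * t = 2 * pi"
      "\<And>s. dist (cis s) (cis (s + t)) < \<delta>"
    using fine_regular_polygon[OF \<delta>(1)] by metis
  \<comment> \<open>The vertices of the regular \<open>N\<close>-gon, traversed once as \<open>i\<close> runs from \<open>0\<close> to \<open>N\<close>.\<close>
  define x where "x i = cis (real i * t)" for i :: nat
  have Suc: "real (Suc i) * t = real i * t + t" for i by (simp add: algebra_simps)
  have x: "norm (x i) = 1" for i by (simp add: x_def)
  have xx: "double_angle (x i) (x (Suc i)) = 2 * t" for i
    unfolding x_def Suc using t(1,2) by (rule double_angle_cis)
  have close: "limit_close b F (g (x i)) (g (x (Suc i)))" for i
    using \<delta>(2)[OF x[of i] x[of "Suc i"]] t(4)[of "i * t"] unfolding x_def Suc by simp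
  obtain \<alpha> q where \<alpha>: "\<And>i. echain F b (q i) (\<alpha> i)" "\<And>i. g (x i) F = echain_class F (\<alpha> i)"
    "\<And>i. (q i, q (Suc i)) \<in> F" "\<And>i. \<alpha> (Suc i) = \<alpha> i @ [q (Suc i)]"
    using chain_along_limit_sequence[of F "\<lambda>i. g (x i)" b, OF F(1) lim[OF x] close] by metis
  have gE: "g (x i) E = echain_class E (\<alpha> i)" for i
    using limit_space_bonding[OF lim[OF x] F(1) E FE, of i] \<alpha>(2) bonding_echain_class[OF FE] by metis
  have edge: "lifted_sum E d (\<alpha> (Suc i)) = lifted_sum E d (\<alpha> i) + (2 * t + k (x (Suc i)) - k (x i))" for i
  proof -
    obtain S where "S \<in> sheets b E \<V>" "echain_class E (\<alpha> i) \<in> S" "echain_class E (\<alpha> (Suc i)) \<in> S"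
      using common_sheet[OF E F(2) entourage_refl[OF F(1)] echain_mono[OF \<alpha>(1) FE] \<alpha>(3)[of i] \<alpha>(3)[of i]] \<alpha>(4)
      by metis
    then have "d (echain_class E (\<alpha> i)) (echain_class E (\<alpha> (Suc i))) = 2 * t + k (x (Suc i)) - k (x i)"
      using dg[OF _ x x] xx unfolding gE by metis
    then show ?thesis
      by (simp add: \<alpha>(4) lifted_sum_snoc)
  qed
  \<comment> \<open>At \<open>n = N\<close> the terms in \<open>k\<close> cancel and \<open>2 * (N * t)\<close> is \<open>4 * pi\<close>.\<close>
  have total: "lifted_sum E d (\<alpha> n) = lifted_sum E d (\<alpha> 0) + 2 * (n * t) + k (x n) - k (x 0)" for n
    by (induction n) (simp_all add: edge algebra_simps)
  have xN: "x N = x 0"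
    using t(3) by (simp add: x_def)
  have hom: "echain_homotopic F (\<alpha> N) (\<alpha> 0)"
    using \<alpha>(2) xN by (metis echain_class_eq_iff)
  have "lifted_sum E d (\<alpha> N) = lifted_sum E d (\<alpha> 0)"
  proof (rule lifted_sum_homotopic[OF F(1) FE _ hom])
    show "hd (\<alpha> N) = b" using \<alpha>(1)[of N] by (simp add: echain_def)
    fix \<beta> p y z assume "echain F b p \<beta>" "(p, y) \<in> F" "(p, z) \<in> F"
    then show "d (echain_class E \<beta>) (echain_class E (\<beta> @ [z])) =
      d (echain_class E \<beta>) (echain_class E (\<beta> @ [y])) +
      d (echain_class E (\<beta> @ [y])) (echain_class E (\<beta> @ [z]))"
      using common_sheet[OF E F(2) entourage_refl[OF F(1)] echain_mono[OF _ FE]] d by metis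
  qed
  then show False
    using total[of N] t(3) xN by simp
qed

end
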